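(* Let $V$ be a finite dimensional vector space over a field $F$ of characteristic $\neq 2$, let $Q$ be a nondegenerate symmetric bilinear form on $V$, and let $e_1,\dots,e_n$ be a $Q$-orthogonal basis of $V$. Let $I,J$ be disjoint multi-indices. Then in $C\ell(V,Q)$ one has $e_Ie_J=(-1)^{|I||J|}e_Je_I$.
   Context: $C\ell(V,Q)$ is the Clifford algebra over $F$ of $(V,Q)$, with sign convention $v\cdot v=-Q(v,v)1$ for $v\in V$. A multi-index is a tuple $I=(i_1,\dots,i_k)$, $k\ge1$, with $1\le i_1<\dots<i_k\le n$, identified with the set of its entries; $|I|=k$ and $e_I=e_{i_1}e_{i_2}\cdots e_{i_k}$. *)

theory Defs
  imports Complex_Main "HOL-Library.Poly_Mapping" "HOL-Algebra.QuotRing" "HOL-Algebra.Module"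
begin

section \<open>Symmetric bilinear forms and orthogonal bases\<close>

definition nondegenerate_form :: "('v::zero \<Rightarrow> 'v \<Rightarrow> 'f::zero) \<Rightarrow> bool" where
  "nondegenerate_form Q \<longleftrightarrow> (\<forall>v. (\<forall>w. Q v w = 0) \<longrightarrow> v = 0)"

context vector_space
begin

definition symmetric_bilinear_form :: "('b \<Rightarrow> 'b \<Rightarrow> 'a) \<Rightarrow> bool" where
  "symmetric_bilinear_form Q \<longleftrightarrow>
     (\<forall>v. Vector_Spaces.linear scale (*) (Q v)) \<and>
     (\<forall>w. Vector_Spaces.linear scale (*) (\<lambda>v. Q v w)) \<and>
     (\<forall>v w. Q v w = Q w v)"

definition orthogonal_basis :: "('b \<Rightarrow> 'b \<Rightarrow> 'a) \<Rightarrow> nat \<Rightarrow> (nat \<Rightarrow> 'b) \<Rightarrow> bool" where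
  "orthogonal_basis Q n e \<longleftrightarrow>
     inj_on e {1..n} \<and> independent (e ` {1..n}) \<and> span (e ` {1..n}) = UNIV \<and>
     (\<forall>i\<in>{1..n}. \<forall>j\<in>{1..n}. i \<noteq> j \<longrightarrow> Q (e i) (e j) = 0)"

end


section \<open>The free algebra on a set of letters\<close>

text \<open>
  Words form the free monoid, written additively because the convolution product of
  \<^type>\<open>poly_mapping\<close> is taken over a \<^class>\<open>monoid_add\<close>. Hence finitely supported functions
  from words over \<open>'v\<close> to \<open>'f\<close> form the free associative unital \<open>'f\<close>-algebra on the set \<open>'v\<close>.
\<close>

datatype 'v word = Word "'v list"

instantiation word :: (type) monoid_add
begin

definition zero_word :: "'a word" where "0 = Word []"

fun plus_word :: "'a word \<Rightarrow> 'a word \<Rightarrow> 'a word" where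
  "Word xs + Word ys = Word (xs @ ys)"

instance
proof
  fix a b c :: "'a word"
  show "a + b + c = a + (b + c)" by (cases a; cases b; cases c) simp
  show "0 + a = a" by (cases a) (simp add: zero_word_def)
  show "a + 0 = a" by (cases a) (simp add: zero_word_def)
qed

end

type_synonym ('v, 'f) free_alg = "'v word \<Rightarrow>\<^sub>0 'f"

abbreviation scalar :: "'f::field \<Rightarrow> ('v, 'f) free_alg" where
  "scalar c \<equiv> Poly_Mapping.single 0 c"

abbreviation letter :: "'v \<Rightarrow> ('v, 'f::field) free_alg" where
  "letter v \<equiv> Poly_Mapping.single (Word [v]) 1"

definition free_ring :: "('v, 'f::field) free_alg ring" where
  "free_ring = \<lparr>carrier = UNIV, mult = (*), one = 1, zero = 0, add = (+)\<rparr>"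

lemma ring_free_ring: "ring free_ring"
proof -
  have "\<exists>y. y + x = 0 \<and> x + y = 0" for x :: "('a, 'b) free_alg"
    by (rule exI[of _ "- x"]) simp
  then show ?thesis
    by unfold_locales
      (auto simp: free_ring_def Units_def algebra_simps)
qed


section \<open>The Clifford algebra\<close>

text \<open>
  Modulo the first two families of relations, the free algebra on the underlying set of the vector
  space is its tensor algebra. The third family imposes \<open>v \<cdot> v = - Q(v,v) 1\<close>.
\<close>

definition clifford_relations ::
    "('f::field \<Rightarrow> 'v::ab_group_add \<Rightarrow> 'v) \<Rightarrow> ('v \<Rightarrow> 'v \<Rightarrow> 'f) \<Rightarrow> ('v, 'f) free_alg set" where
  "clifford_relations scale Q =
     {letter (v + w) - (letter v + letter w) | v w. True} \<union>
     {letter (scale c v) - scalar c * letter v | c v. True} \<union>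
     {letter v * letter v + scalar (Q v v) | v. True}"

definition clifford_ideal ::
    "('f::field \<Rightarrow> 'v::ab_group_add \<Rightarrow> 'v) \<Rightarrow> ('v \<Rightarrow> 'v \<Rightarrow> 'f) \<Rightarrow> ('v, 'f) free_alg set" where
  "clifford_ideal scale Q = Idl\<^bsub>free_ring\<^esub> (clifford_relations scale Q)"

definition clifford_class ::
    "('f::field \<Rightarrow> 'v::ab_group_add \<Rightarrow> 'v) \<Rightarrow> ('v \<Rightarrow> 'v \<Rightarrow> 'f) \<Rightarrow>
     ('v, 'f) free_alg \<Rightarrow> ('v, 'f) free_alg set" where
  "clifford_class scale Q x = clifford_ideal scale Q +>\<^bsub>free_ring\<^esub> x"

definition clifford ::
    "('f::field \<Rightarrow> 'v::ab_group_add \<Rightarrow> 'v) \<Rightarrow> ('v \<Rightarrow> 'v \<Rightarrow> 'f) \<Rightarrow>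
     ('f, ('v, 'f) free_alg set) module" where
  "clifford scale Q = (let A = free_ring Quot clifford_ideal scale Q in
     \<lparr>carrier = carrier A, mult = mult A, one = one A, zero = zero A, add = add A,
      smult = (\<lambda>c x. clifford_class scale Q (scalar c) \<otimes>\<^bsub>A\<^esub> x)\<rparr>)"

definition clifford_vec ::
    "('f::field \<Rightarrow> 'v::ab_group_add \<Rightarrow> 'v) \<Rightarrow> ('v \<Rightarrow> 'v \<Rightarrow> 'f) \<Rightarrow> 'v \<Rightarrow> ('v, 'f) free_alg set" where
  "clifford_vec scale Q v = clifford_class scale Q (letter v)"

lemma ideal_clifford_ideal: "ideal (clifford_ideal scale Q) free_ring"
  unfolding clifford_ideal_def
  by (rule ring.genideal_ideal[OF ring_free_ring]) (simp add: free_ring_def)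

lemma ring_clifford: "ring (clifford scale Q)"
proof -
  interpret A: ring "free_ring Quot clifford_ideal scale Q"
    by (rule ideal.quotient_is_ring[OF ideal_clifford_ideal])
  have inv: "\<exists>y\<in>carrier (free_ring Quot clifford_ideal scale Q).
        y \<oplus>\<^bsub>free_ring Quot clifford_ideal scale Q\<^esub> x = \<zero>\<^bsub>free_ring Quot clifford_ideal scale Q\<^esub> \<and>
        x \<oplus>\<^bsub>free_ring Quot clifford_ideal scale Q\<^esub> y = \<zero>\<^bsub>free_ring Quot clifford_ideal scale Q\<^esub>"
    if "x \<in> carrier (free_ring Quot clifford_ideal scale Q)" for x
    using that A.l_neg A.r_neg A.a_inv_closed by blast
  show ?thesis
  proof (rule ringI)
    show "abelian_group (clifford scale Q)"
      by (rule abelian_groupI)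
        (simp_all add: clifford_def Let_def inv A.a_ac)
    show "Group.monoid (clifford scale Q)"
      by (rule monoidI) (auto simp: clifford_def Let_def A.m_assoc)
  qed (auto simp: clifford_def Let_def A.l_distr A.r_distr)
qed

lemma clifford_class_closed: "clifford_class scale Q x \<in> carrier (clifford scale Q)"
  by (auto simp: clifford_def Let_def FactRing_def A_RCOSETS_def' a_r_coset_def' clifford_class_def
      free_ring_def)

lemma clifford_class_add:
  "clifford_class scale Q x \<oplus>\<^bsub>clifford scale Q\<^esub> clifford_class scale Q y = clifford_class scale Q (x + y)"
  using ring_hom_add[OF ideal.rcos_ring_hom[OF ideal_clifford_ideal[of scale Q]], of x y]
  by (simp add: clifford_def Let_def clifford_class_def free_ring_def)

lemma clifford_class_mult:
  "clifford_class scale Q x \<otimes>\<^bsub>clifford scale Q\<^esub> clifford_class scale Q y = clifford_class scale Q (x * y)"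
  using ring_hom_mult[OF ideal.rcos_ring_hom[OF ideal_clifford_ideal[of scale Q]], of x y]
  by (simp add: clifford_def Let_def clifford_class_def free_ring_def)

lemma clifford_class_smult:
  "c \<odot>\<^bsub>clifford scale Q\<^esub> clifford_class scale Q x = clifford_class scale Q (scalar c * x)"
  using clifford_class_mult[of scale Q "scalar c" x]
  by (simp add: clifford_def Let_def)

lemma clifford_class_one: "\<one>\<^bsub>clifford scale Q\<^esub> = clifford_class scale Q 1"
  by (simp add: clifford_def Let_def clifford_class_def FactRing_def free_ring_def)

lemma clifford_class_eqI:
  assumes "x - y \<in> clifford_relations scale Q"
  shows "clifford_class scale Q x = clifford_class scale Q y"
proof -
  interpret I: ideal "clifford_ideal scale Q" free_ring by (rule ideal_clifford_ideal)
  have "x - y \<in> clifford_ideal scale Q"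
    using I.genideal_self[of "clifford_relations scale Q"] assms
    by (auto simp: clifford_ideal_def free_ring_def)
  then have "x \<in> clifford_ideal scale Q +>\<^bsub>free_ring\<^esub> y"
    by (auto simp: a_r_coset_def' free_ring_def intro!: bexI[of _ "x - y"])
  then show ?thesis
    unfolding clifford_class_def
    by (intro I.a_repr_independence[symmetric] I.a_subgroup) (simp_all add: free_ring_def)
qed

lemma clifford_vec_add:
  "clifford_vec scale Q (v + w) =
   clifford_vec scale Q v \<oplus>\<^bsub>clifford scale Q\<^esub> clifford_vec scale Q w"
  unfolding clifford_vec_def clifford_class_add
  by (rule clifford_class_eqI) (auto simp: clifford_relations_def)

lemma clifford_vec_scale:
  "clifford_vec scale Q (scale c v) = c \<odot>\<^bsub>clifford scale Q\<^esub> clifford_vec scale Q v"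
  unfolding clifford_vec_def clifford_class_smult
  by (rule clifford_class_eqI) (auto simp: clifford_relations_def)

lemma clifford_vec_square:
  "clifford_vec scale Q v \<otimes>\<^bsub>clifford scale Q\<^esub> clifford_vec scale Q v =
   (- Q v v) \<odot>\<^bsub>clifford scale Q\<^esub> \<one>\<^bsub>clifford scale Q\<^esub>"
proof -
  have "letter v * letter v - scalar (- Q v v) \<in> clifford_relations scale Q"
    by (auto simp: clifford_relations_def single_uminus)
  then show ?thesis
    unfolding clifford_vec_def clifford_class_mult clifford_class_one clifford_class_smult
    by (simp add: clifford_class_eqI)
qed


section \<open>Multi-indices\<close>

definition multi_index :: "nat \<Rightarrow> nat list \<Rightarrow> bool" where
  "multi_index n I \<longleftrightarrow> I \<noteq> [] \<and> sorted_wrt (<) I \<and> set I \<subseteq> {1..n}"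

definition clifford_monomial ::
    "('f::field \<Rightarrow> 'v::ab_group_add \<Rightarrow> 'v) \<Rightarrow> ('v \<Rightarrow> 'v \<Rightarrow> 'f) \<Rightarrow> (nat \<Rightarrow> 'v) \<Rightarrow> nat list \<Rightarrow>
     ('v, 'f) free_alg set" where
  "clifford_monomial scale Q e I =
     foldr (\<lambda>i x. clifford_vec scale Q (e i) \<otimes>\<^bsub>clifford scale Q\<^esub> x) I \<one>\<^bsub>clifford scale Q\<^esub>"

end

theory Submission
  imports Defs
begin

text \<open>Orthogonal vectors anticommute in the Clifford algebra: expand the square of
  \<open>v + w\<close> and cancel the squares of \<open>v\<close> and \<open>w\<close>. Disjointness
  makes every letter of \<open>e_I\<close> orthogonal to every letter of \<open>e_J\<close>, so each
  of the |I||J| transpositions that carry \<open>e_I\<close> past \<open>e_J\<close> costs one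
  factor -1. The counting is done with the relation xy = (-1)^p yx, which is symmetric in x and y
  and whose exponents add when y is a product
  (\<open>clifford_class_skew_commute_mult_right\<close>). All calculation takes place on
  representatives in the free algebra, modulo equality of \<open>clifford_class\<close>, so that
  ordinary ring simplification applies.\<close>

lemma clifford_class_mult_cong:
  assumes "clifford_class scale Q x = clifford_class scale Q x'"
    and "clifford_class scale Q y = clifford_class scale Q y'"
  shows "clifford_class scale Q (x * y) = clifford_class scale Q (x' * y')"
  by (simp only: clifford_class_mult[symmetric] assms)

lemma clifford_class_add_cong:
  assumes "clifford_class scale Q x = clifford_class scale Q x'"
    and "clifford_class scale Q y = clifford_class scale Q y'"
  shows "clifford_class scale Q (x + y) = clifford_class scale Q (x' + y')"
  by (simp only: clifford_class_add[symmetric] assms)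

lemma clifford_class_uminus_cong:
  assumes "clifford_class scale Q x = clifford_class scale Q x'"
  shows "clifford_class scale Q (- x) = clifford_class scale Q (- x')"
  using clifford_class_mult_cong[OF refl[of "clifford_class scale Q (- 1)"] assms] by simp

lemma clifford_class_letter_square:
  "clifford_class scale Q (letter v * letter v) = clifford_class scale Q (- scalar (Q v v))"
  by (rule clifford_class_eqI) (auto simp: clifford_relations_def)

text \<open>Polarization of the relation for squares. For bilinear \<open>Q\<close> the assumption
  amounts to \<open>Q v w + Q w v = 0\<close>.\<close>

lemma clifford_class_letter_anticommute:
  assumes "Q (v + w) (v + w) = Q v v + Q w w"
  shows "clifford_class scale Q (letter v * letter w) = clifford_class scale Q (- (letter w * letter v))"
proof -
  let ?c = "clifford_class scale Q"
  let ?v = "letter v :: ('b, 'a) free_alg" and ?w = "letter w :: ('b, 'a) free_alg"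
  have sum: "?c (letter (v + w)) = ?c (?v + ?w)"
    by (rule clifford_class_eqI) (auto simp: clifford_relations_def)
  have "?c ((?v + ?w) * (?v + ?w)) = ?c (- scalar (Q v v + Q w w))"
    using clifford_class_mult_cong[OF sum sum] clifford_class_letter_square[of scale Q "v + w"] assms
    by simp
  \<comment> \<open>The added terms leave only \<open>?v * ?w\<close> on the left; on the right the
    scalars cancel and \<open>- (?w * ?v)\<close> remains.\<close>
  then have "?c ((?v + ?w) * (?v + ?w) + (- (?v * ?v) + - (?w * ?w) + - (?w * ?v))) =
      ?c (- scalar (Q v v + Q w w) + (- (- scalar (Q v v)) + - (- scalar (Q w w)) + - (?w * ?v)))"
    by (intro clifford_class_add_cong clifford_class_uminus_cong clifford_class_letter_square refl)
  then show ?thesis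
    by (simp add: algebra_simps single_add)
qed

lemma minus_one_power_central: "(- 1) ^ p * x = x * (- 1) ^ p" for x :: "'a::ring_1"
  by (cases "even p") simp_all

text \<open>Move \<open>x\<close> past \<open>y\<close>, then past \<open>z\<close>; the second sign
  is central and can be pulled out to the left of \<open>y\<close>.\<close>

lemma clifford_class_skew_commute_mult_right:
  assumes xy: "clifford_class scale Q (x * y) = clifford_class scale Q ((- 1) ^ p * (y * x))"
    and xz: "clifford_class scale Q (x * z) = clifford_class scale Q ((- 1) ^ q * (z * x))"
  shows "clifford_class scale Q (x * (y * z)) =
    clifford_class scale Q ((- 1) ^ (p + q) * ((y * z) * x))"
proof -
  have "clifford_class scale Q (x * (y * z)) = clifford_class scale Q ((- 1) ^ p * y * (x * z))"
    using clifford_class_mult_cong[OF xy refl, of z] by (simp add: mult.assoc)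
  also have "\<dots> = clifford_class scale Q ((- 1) ^ p * y * ((- 1) ^ q * (z * x)))"
    by (rule clifford_class_mult_cong[OF refl xz])
  also have "(- 1) ^ p * y * ((- 1) ^ q * (z * x)) = (- 1) ^ p * (y * (- 1) ^ q) * (z * x)"
    by (simp only: mult.assoc)
  also have "\<dots> = (- 1) ^ (p + q) * ((y * z) * x)"
    by (simp only: minus_one_power_central[of q y, symmetric] power_add mult.assoc)
  finally show ?thesis .
qed

text \<open>Holds because (-1)^p is its own inverse. It lets a lemma about products in the right
  factor serve for the left factor too.\<close>

lemma clifford_class_skew_commute_sym:
  assumes "clifford_class scale Q (x * y) = clifford_class scale Q ((- 1) ^ p * (y * x))"
  shows "clifford_class scale Q (y * x) = clifford_class scale Q ((- 1) ^ p * (x * y))"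
  using assms clifford_class_uminus_cong[OF assms] by (cases "even p") simp_all

definition free_monomial :: "(nat \<Rightarrow> 'v) \<Rightarrow> nat list \<Rightarrow> ('v, 'f::field) free_alg" where
  "free_monomial e I = foldr (\<lambda>i x. letter (e i) * x) I 1"

lemma free_monomial_simps [simp]:
  "free_monomial e [] = 1"
  "free_monomial e (i # I) = letter (e i) * free_monomial e I"
  by (simp_all add: free_monomial_def)

lemma clifford_monomial_eq_class:
  "clifford_monomial scale Q e I = clifford_class scale Q (free_monomial e I)"
  by (induction I)
    (simp_all add: clifford_monomial_def clifford_class_one clifford_vec_def clifford_class_mult)

text \<open>Each letter of the monomial contributes \<open>p\<close> to the exponent, by induction
  on \<open>J\<close>.\<close>

lemma clifford_class_skew_commute_monomial:
  assumes "\<And>j. j \<in> set J \<Longrightarrow>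
    clifford_class scale Q (x * letter (e j)) = clifford_class scale Q ((- 1) ^ p * (letter (e j) * x))"
  shows "clifford_class scale Q (x * free_monomial e J) =
    clifford_class scale Q ((- 1) ^ (p * length J) * (free_monomial e J * x))"
  using assms
proof (induction J)
  case (Cons j J)
  then show ?case
    using clifford_class_skew_commute_mult_right[of scale Q x "letter (e j)" p "free_monomial e J"]
    by simp
qed simp

text \<open>Identifies the sign in the field, used by the scalar action, with the sign in the free
  algebra.\<close>

lemma scalar_minus_one_power: "scalar ((- 1) ^ p) = (- 1) ^ p"
  by (cases "even p") (simp_all add: single_uminus)

theorem proposition3p1:
  fixes scale :: "'f::field \<Rightarrow> 'v::ab_group_add \<Rightarrow> 'v"
    and Q :: "'v \<Rightarrow> 'v \<Rightarrow> 'f" and e :: "nat \<Rightarrow> 'v" and n :: nat and I J :: "nat list"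
  assumes "CHAR('f) \<noteq> 2"
    and "vector_space scale"
    and "\<exists>B. finite_dimensional_vector_space scale B"
    and "vector_space.symmetric_bilinear_form scale Q"
    and "nondegenerate_form Q"
    and "vector_space.orthogonal_basis scale Q n e"
    and "multi_index n I" and "multi_index n J" and "set I \<inter> set J = {}"
  shows "clifford_monomial scale Q e I \<otimes>\<^bsub>clifford scale Q\<^esub> clifford_monomial scale Q e J =
    ((- 1) ^ (length I * length J)) \<odot>\<^bsub>clifford scale Q\<^esub>
      (clifford_monomial scale Q e J \<otimes>\<^bsub>clifford scale Q\<^esub> clifford_monomial scale Q e I)"
proof -
  interpret vector_space scale by (rule assms(2))
  let ?c = "clifford_class scale Q"
  have right: "Vector_Spaces.linear scale (*) (Q v)"
    and left: "Vector_Spaces.linear scale (*) (\<lambda>v. Q v w)" for v w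
    using assms(4) unfolding symmetric_bilinear_form_def by blast+
  have lin: "Q v (x + y) = Q v x + Q v y" "Q (x + y) v = Q x v + Q y v" for v x y
    using right[of v] left[of v] unfolding Vector_Spaces.linear_iff by blast+
  \<comment> \<open>The exponent 1 is written out to match the skew-commutation lemmas with
    \<open>p = 1\<close>.\<close>
  have letters: "?c (letter (e i) * letter (e j)) = ?c ((- 1) ^ 1 * (letter (e j) * letter (e i)))"
    if "i \<in> set I" "j \<in> set J" for i j
  proof -
    have "i \<in> {1..n}" "j \<in> {1..n}" "i \<noteq> j"
      using that assms(7-9) by (auto simp: multi_index_def)
    then have "Q (e i) (e j) = 0" "Q (e j) (e i) = 0"
      using assms(6) by (simp_all add: orthogonal_basis_def)
    then show ?thesis
      using clifford_class_letter_anticommute[of Q "e i" "e j" scale] by (simp add: lin)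
  qed
  have "?c (letter (e i) * free_monomial e J) =
      ?c ((- 1) ^ length J * (free_monomial e J * letter (e i)))" if "i \<in> set I" for i
    using clifford_class_skew_commute_monomial[OF letters[OF that]] by simp
  \<comment> \<open>After the flip the whole monomial of \<open>J\<close> plays the role of
    \<open>x\<close>, with \<open>p = length J\<close>, and the same lemma runs over the letters of
    \<open>I\<close>.\<close>
  note clifford_class_skew_commute_sym[OF this]
  then have "?c (free_monomial e J * free_monomial e I) =
      ?c ((- 1) ^ (length J * length I) * (free_monomial e I * free_monomial e J))"
    by (rule clifford_class_skew_commute_monomial)
  from clifford_class_skew_commute_sym[OF this] show ?thesis
    by (simp add: clifford_monomial_eq_class clifford_class_mult clifford_class_smult
        scalar_minus_one_power mult.commute[of "length J"])
qed

end
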